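(* Let $H$ be a real Hilbert space, let $P$ be an orthogonal projector in $H$, let $P^\perp=I-P$, and let $A:H\to H$ be a bounded linear operator with $A=A^*\ge 0$. Let the range $\mathbf D=\mathbf R(A)$ be closed, let $D$ be the orthogonal projector onto $\mathbf D$, and let $\rho_D>0$ be a finite constant such that $$(A\varepsilon,\varepsilon)\ge\tfrac1{\rho_D}\|\varepsilon\|^2\quad\text{for all }\varepsilon\in\mathbf D .\qquad ( * )$$ Then the condition $$\text{there is a finite }\rho>0\text{ such that }(A\varepsilon,\varepsilon)\ge\tfrac1\rho\|\varepsilon\|^2\ \text{ for all }\varepsilon\in P^\perp\mathbf R(A)\qquad( ** )$$ is equivalent to $$\kappa:=\inf_{\psi\in P^\perp\mathbf D}\frac{\|D\psi\|}{\|\psi\|}>0 .$$ In particular, $( * )$ and $\kappa>0$ imply the inequality in $( ** )$ with $\rho=\rho_D/\kappa^2$.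
   Context: $\mathbf R(A)$ denotes the range of $A$, and $P^\perp\mathbf D=\{P^\perp x:x\in\mathbf D\}$. In the infimum, arguments for which both numerator and denominator vanish (i.e. $\psi=0$) are excluded. An infimum over the empty set (the case $P^\perp\mathbf D=\{0\}$) is taken to be $1$. *)

theory Defs
  imports "HOL-Analysis.Analysis"
begin

text \<open>
  A real Hilbert space is a type of class \<open>{real_inner, complete_space}\<close>.
  The library constant \<^const>\<open>adjoint\<close> is a choice operator, whose defining property
  is only proved there for Euclidean spaces. Hence \<open>A = A\<^sup>*\<close> is stated as: \<open>A\<close> itself satisfies
  the relation that defines the adjoint of \<open>A\<close>.
\<close>

definition self_adjoint :: "('a::real_inner \<Rightarrow> 'a) \<Rightarrow> bool" where
  "self_adjoint A \<longleftrightarrow> (\<forall>x y. A x \<bullet> y = x \<bullet> A y)"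

lemma self_adjoint_imp_adjoint_eq: "self_adjoint A \<Longrightarrow> adjoint A = A"
  by (rule adjoint_unique) (simp add: self_adjoint_def)

definition orthogonal_projector :: "('a::real_inner \<Rightarrow> 'a) \<Rightarrow> bool" where
  "orthogonal_projector P \<longleftrightarrow> bounded_linear P \<and> P \<circ> P = P \<and> self_adjoint P"

definition orthogonal_projector_onto :: "('a::real_inner \<Rightarrow> 'a) \<Rightarrow> 'a set \<Rightarrow> bool" where
  "orthogonal_projector_onto P M \<longleftrightarrow> orthogonal_projector P \<and> range P = M"

definition complementary_projector :: "('a::real_inner \<Rightarrow> 'a) \<Rightarrow> 'a \<Rightarrow> 'a" where
  "complementary_projector P = (\<lambda>x. x - P x)"

text \<open>
  The infimum of \<open>\<parallel>D \<psi>\<parallel> / \<parallel>\<psi>\<parallel>\<close> over the nonzero \<open>\<psi> \<in> S\<close>. The infimum over the empty set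
  is \<open>1\<close> by convention; this has to be said explicitly because \<open>Inf {} :: real\<close> is unspecified.
\<close>

definition inf_ratio :: "('a::real_inner \<Rightarrow> 'a) \<Rightarrow> 'a set \<Rightarrow> real" where
  "inf_ratio D S =
    (if S - {0} = {} then 1 else (INF \<psi>\<in>S - {0}. norm (D \<psi>) / norm \<psi>))"

end

theory Submission
  imports Defs
begin

text \<open>
  A self-adjoint \<open>A\<close> annihilates the orthogonal complement of its range, so its quadratic form
  only sees the component of a vector in \<open>\<^bold>D = range A\<close>:
  \<open>A \<psi> \<bullet> \<psi> = A (D \<psi>) \<bullet> D \<psi>\<close>. On \<open>\<^bold>D\<close> the form is comparable with the squared norm, from below
  by the coercivity constant \<open>1 / \<rho>\<^sub>D\<close> and from above by boundedness of \<open>A\<close>. Hence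
  \<open>A \<psi> \<bullet> \<psi>\<close> is comparable with \<open>\<parallel>D \<psi>\<parallel>\<^sup>2\<close> for every \<open>\<psi>\<close>, and coercivity of \<open>A\<close> on any set \<open>S\<close>
  means exactly that \<open>\<parallel>D \<psi>\<parallel>\<close> dominates a positive multiple of \<open>\<parallel>\<psi>\<parallel>\<close> on \<open>S\<close>. The best such
  multiple is the infimum \<open>\<kappa>\<close> (lemmas \<open>inf_ratio_mult_norm_le\<close> and \<open>inf_ratio_pos\<close>).
  The set \<open>S\<close> of the theorem is the image of \<open>\<^bold>D\<close> under the complementary projector.
\<close>

text \<open>
  The self-adjoint \<open>D\<close> fixes every \<open>A y\<close>, so \<open>x - D x\<close> is orthogonal to \<open>A y\<close>; moving \<open>A\<close> across
  the inner product shows that \<open>A (x - D x)\<close> is orthogonal to every \<open>y\<close>.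
\<close>

lemma self_adjoint_comp_range_projector:
  assumes "bounded_linear A" and "self_adjoint A"
    and "orthogonal_projector_onto D (range A)"
  shows "A (D x) = A x"
proof -
  interpret A: bounded_linear A by fact
  have D: "D (D z) = D z" "D z \<bullet> w = z \<bullet> D w" "range D = range A" for z w
    using assms(3)
    by (auto simp: orthogonal_projector_onto_def orthogonal_projector_def self_adjoint_def
        dest: fun_cong[where x = z])
  have "A (x - D x) \<bullet> y = 0" for y
  proof -
    obtain z where z: "A y = D z"
      using D(3) by (metis rangeE rangeI)
    have "A (x - D x) \<bullet> y = x \<bullet> D z - D x \<bullet> D z"
      using assms(2) z by (simp add: self_adjoint_def inner_diff_left)
    then show ?thesis
      by (simp add: D(1,2))
  qed
  then have "A (x - D x) = 0"
    by (metis inner_eq_zero_iff)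
  then show ?thesis
    by (simp add: A.diff)
qed

lemma quadratic_form_range_projector:
  assumes "bounded_linear A" and "self_adjoint A"
    and "orthogonal_projector_onto D (range A)"
  shows "A x \<bullet> x = A (D x) \<bullet> D x"
  using self_adjoint_comp_range_projector[OF assms] assms(2)
  by (metis self_adjoint_def)

lemma inf_ratio_mult_norm_le:
  assumes "D 0 = 0" and "\<psi> \<in> S"
  shows "inf_ratio D S * norm \<psi> \<le> norm (D \<psi>)"
proof (cases "\<psi> = 0")
  case False
  then have mem: "\<psi> \<in> S - {0}"
    using assms(2) by simp
  have "bdd_below ((\<lambda>\<psi>. norm (D \<psi>) / norm \<psi>) ` (S - {0}))"
    by (rule bdd_belowI2[where m = 0]) simp
  then have "inf_ratio D S \<le> norm (D \<psi>) / norm \<psi>"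
    using mem unfolding inf_ratio_def by (auto intro: cINF_lower)
  then show ?thesis
    using False by (simp add: field_simps)
qed (use assms(1) in simp)

text \<open>
  A uniform positive lower bound for the quotients passes to their infimum. When \<open>S\<close> has no nonzero
  element, positivity comes from the convention that the infimum is \<open>1\<close>.
\<close>

lemma inf_ratio_pos:
  assumes "c > 0" and "\<And>\<psi>. \<psi> \<in> S \<Longrightarrow> c * norm \<psi> \<le> norm (D \<psi>)"
  shows "inf_ratio D S > 0"
proof (cases "S - {0} = {}")
  case False
  then have "c \<le> (INF \<psi>\<in>S - {0}. norm (D \<psi>) / norm \<psi>)"
    using assms(2) by (intro cINF_greatest) (auto simp: field_simps)
  then show ?thesis
    using False assms(1) by (simp add: inf_ratio_def)
qed (simp add: inf_ratio_def)

text \<open>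
  The passage from \<open>\<kappa> > 0\<close> to coercivity with its explicit constant: the restriction to \<open>range A\<close>
  costs the factor \<open>1 / \<rho>\<^sub>D\<close>, and replacing \<open>\<parallel>D \<psi>\<parallel>\<close> by \<open>\<kappa> \<parallel>\<psi>\<parallel>\<close> in a quadratic expression
  costs \<open>\<kappa>\<^sup>2\<close>.
\<close>

lemma coercive_if_inf_ratio_pos:
  assumes "bounded_linear A" and "self_adjoint A"
    and "orthogonal_projector_onto D (range A)"
    and "r > 0" and "\<forall>\<epsilon>\<in>range A. A \<epsilon> \<bullet> \<epsilon> \<ge> 1 / r * (norm \<epsilon>)\<^sup>2"
    and "inf_ratio D S > 0" and "\<psi> \<in> S"
  shows "A \<psi> \<bullet> \<psi> \<ge> 1 / (r / (inf_ratio D S)\<^sup>2) * (norm \<psi>)\<^sup>2"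
proof -
  have D: "D \<psi> \<in> range A" "D 0 = 0"
    using assms(3)
    by (auto simp: orthogonal_projector_onto_def orthogonal_projector_def linear_simps)
  have "(inf_ratio D S * norm \<psi>)\<^sup>2 \<le> (norm (D \<psi>))\<^sup>2"
    using assms(6) by (intro power_mono inf_ratio_mult_norm_le[where D = D, OF D(2) assms(7)]) simp
  then have "1 / r * (inf_ratio D S * norm \<psi>)\<^sup>2 \<le> 1 / r * (norm (D \<psi>))\<^sup>2"
    using assms(4) by (intro mult_left_mono) simp_all
  also have "\<dots> \<le> A (D \<psi>) \<bullet> D \<psi>"
    using assms(5) D(1) by blast
  also have "\<dots> = A \<psi> \<bullet> \<psi>"
    by (rule quadratic_form_range_projector[OF assms(1-3), symmetric])
  finally show ?thesis
    by (simp add: power_mult_distrib)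
qed

text \<open>
  Conversely, if \<open>K\<close> bounds the norm of \<open>A\<close>, then
  \<open>\<parallel>\<psi>\<parallel>\<^sup>2 / r \<le> A \<psi> \<bullet> \<psi> = A (D \<psi>) \<bullet> D \<psi> \<le> K \<parallel>D \<psi>\<parallel>\<^sup>2\<close>,
  so every quotient is at least \<open>1 / sqrt (r K)\<close>.
\<close>

lemma inf_ratio_pos_if_coercive:
  assumes "bounded_linear A" and "self_adjoint A"
    and "orthogonal_projector_onto D (range A)"
    and "r > 0" and "\<forall>\<epsilon>\<in>S. A \<epsilon> \<bullet> \<epsilon> \<ge> 1 / r * (norm \<epsilon>)\<^sup>2"
  shows "inf_ratio D S > 0"
proof -
  obtain K where K: "K > 0" "\<And>x. norm (A x) \<le> norm x * K"
    using bounded_linear.pos_bounded[OF assms(1)] by blast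
  have "1 / sqrt (r * K) * norm \<psi> \<le> norm (D \<psi>)" if "\<psi> \<in> S" for \<psi>
  proof -
    have "1 / r * (norm \<psi>)\<^sup>2 \<le> A \<psi> \<bullet> \<psi>"
      using assms(5) that by blast
    also have "\<dots> = A (D \<psi>) \<bullet> D \<psi>"
      by (rule quadratic_form_range_projector[OF assms(1-3)])
    also have "\<dots> \<le> norm (A (D \<psi>)) * norm (D \<psi>)"
      by (rule norm_cauchy_schwarz)
    also have "\<dots> \<le> (norm (D \<psi>) * K) * norm (D \<psi>)"
      by (intro mult_right_mono K(2)) simp
    finally have "(norm \<psi>)\<^sup>2 \<le> r * K * (norm (D \<psi>))\<^sup>2"
      using assms(4) by (simp add: field_simps power2_eq_square)
    then have "norm \<psi> \<le> sqrt (r * K * (norm (D \<psi>))\<^sup>2)"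
      by (rule real_le_rsqrt)
    then show ?thesis
      using assms(4) K(1) by (simp add: real_sqrt_mult field_simps)
  qed
  then show ?thesis
    using assms(4) K(1) by (intro inf_ratio_pos[where c = "1 / sqrt (r * K)"]) simp_all
qed

theorem theorem4p4:
  fixes A P D :: "'a::{real_inner, complete_space} \<Rightarrow> 'a"
    and \<rho>\<^sub>D \<kappa> :: real
  assumes "orthogonal_projector P"
    and "bounded_linear A"
    and "self_adjoint A"
    and "\<forall>x. A x \<bullet> x \<ge> 0"
    and "closed (range A)"
    and "orthogonal_projector_onto D (range A)"
    and "\<rho>\<^sub>D > 0"
    and "\<forall>\<epsilon>\<in>range A. A \<epsilon> \<bullet> \<epsilon> \<ge> 1 / \<rho>\<^sub>D * (norm \<epsilon>)\<^sup>2"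
    and "\<kappa> = inf_ratio D (complementary_projector P ` range A)"
  shows "((\<exists>\<rho>>0. \<forall>\<epsilon>\<in>complementary_projector P ` range A. A \<epsilon> \<bullet> \<epsilon> \<ge> 1 / \<rho> * (norm \<epsilon>)\<^sup>2)
           \<longleftrightarrow> \<kappa> > 0)
       \<and> (\<kappa> > 0 \<longrightarrow>
           (\<forall>\<epsilon>\<in>complementary_projector P ` range A.
              A \<epsilon> \<bullet> \<epsilon> \<ge> 1 / (\<rho>\<^sub>D / \<kappa>\<^sup>2) * (norm \<epsilon>)\<^sup>2))"
proof -
  let ?S = "complementary_projector P ` range A"
  have explicit: "\<forall>\<epsilon>\<in>?S. A \<epsilon> \<bullet> \<epsilon> \<ge> 1 / (\<rho>\<^sub>D / \<kappa>\<^sup>2) * (norm \<epsilon>)\<^sup>2" if "\<kappa> > 0"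
    using coercive_if_inf_ratio_pos[OF assms(2,3,6-8)] that unfolding assms(9) by blast
  have "\<kappa> > 0" if "\<exists>\<rho>>0. \<forall>\<epsilon>\<in>?S. A \<epsilon> \<bullet> \<epsilon> \<ge> 1 / \<rho> * (norm \<epsilon>)\<^sup>2"
    using inf_ratio_pos_if_coercive[OF assms(2,3,6)] that unfolding assms(9) by blast
  moreover have "\<exists>\<rho>>0. \<forall>\<epsilon>\<in>?S. A \<epsilon> \<bullet> \<epsilon> \<ge> 1 / \<rho> * (norm \<epsilon>)\<^sup>2" if "\<kappa> > 0"
    using explicit[OF that] that assms(7) by (intro exI[of _ "\<rho>\<^sub>D / \<kappa>\<^sup>2"]) simp
  ultimately show ?thesis
    using explicit by blast
qed

end
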